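(* Assume the nonresonance condition: the only function $u^h:N^+\to\mathbb{C}$ with $L^h u^h=0$ on $M^+$ and $u^h|_\gamma=0$ is $u^h=0$. Let $S_{\gamma\gamma}$ be the $|\gamma|\times|\gamma|$ matrix $$(S_{\gamma\gamma})_{ij}=h^2G^h_{\gamma_i-\gamma_j},\qquad \gamma_i,\gamma_j\in\gamma,$$ and assume that $S_{\gamma\gamma}$ is nonsingular. For a trace $\xi_\gamma:\gamma\to\mathbb{C}$ let $\lambda=S_{\gamma\gamma}^{-1}\xi_\gamma$, extended by zero away from $\gamma$, and set $V^h=G^h\ast\lambda$ and $\lambda^\pm=\lambda\,\mathbf 1_{\gamma^\pm}$. Then $V^h|_\gamma=\xi_\gamma$, $L^hV^h=\lambda$, and, with $P^h\xi_\gamma$ and $Q^h\xi_\gamma$ formed from this admissible extension $V^h$, $$P^h\xi_\gamma=G^h\ast\lambda^-,\qquad Q^h\xi_\gamma=G^h\ast\lambda^+ .$$ Consequently, the shielding control $g^h_{\rm sh}=-(L^hV^h)\mathbf 1_{M^-}$ and the confinement control $g^h_{\rm conf}=-(L^hV^h)\mathbf 1_{M^+}$ (whose responses are $G^h\ast g^h_{\rm sh}=-P^h\xi_\gamma$ and $G^h\ast g^h_{\rm conf}=-Q^h\xi_\gamma$) are the single-layer densities $$g^h_{\rm sh}=-\lambda^-,\qquad g^h_{\rm conf}=-\lambda^+ .$$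
   Context: Lattice and operator. Let $d\in\{2,3\}$, $h>0$, wavenumber $k>0$. Functions on the lattice $\Lambda_h=h\mathbb{Z}^d$ are indexed by $\mathbb{Z}^d$ (node $h\bm m\leftrightarrow\bm m$). The discrete Helmholtz operator is $$(L^hv)_{\bm m}=-\frac1{h^2}\sum_{\bm e\in\mathbb{Z}^d,\,|\bm e|_1=1}(v_{\bm m+\bm e}-v_{\bm m})-k^2v_{\bm m}.$$ Geometry. $\Omega_{\rm in}\subset\mathbb{R}^d$ is a bounded Lipschitz domain, $M^+=\{\bm m\in\mathbb{Z}^d: h\bm m\in\Omega_{\rm in}\}$, $M^-=\{\bm m\in\mathbb{Z}^d: h\bm m\notin\overline{\Omega_{\rm in}}\}$, and no lattice node lies on $\partial\Omega_{\rm in}$, so $\mathbb{Z}^d=M^+\sqcup M^-$. $N^\pm$ is the set of all nodes of the stencils of $L^h$ centred in $M^\pm$: $N^\pm=M^\pm\cup\{\bm m+\bm e:\bm m\in M^\pm,|\bm e|_1=1\}$. The boundary strip is $\gamma=N^+\cap N^-$, with $\gamma^\pm=\gamma\cap M^\pm$. $\mathbf{1}_A$ is the indicator of $A$. Lattice Green's function. $$G^h_{\bm m}=\frac1{(2\pi)^d}\int_{[-\pi,\pi]^d}\frac{e^{i\bm m\cdot\bm\theta}}{\sigma(\bm\theta)-k^2h^2+i0^+}\,d\bm\theta,\qquad \sigma(\bm\theta)=\sum_{j=1}^d2(1-\cos\theta_j),$$ where $i0^+$ means the limit $\varepsilon\to0^+$ with $i\varepsilon$ in place of $i0^+$; $(h,k)$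 are assumed such that the limit exists. Then $L^hG^h=h^{-2}\delta_{\bm 0}$. For finitely supported $f$, $(G^h\ast f)_{\bm m}=h^2\sum_{\bm n}G^h_{\bm m-\bm n}f_{\bm n}$, so $L^h(G^h\ast f)=f$; $G^h\ast f$ is called the outgoing solution generated by $f$. Admissible extension and potentials. $V^h:\mathbb{Z}^d\to\mathbb{C}$ is an admissible extension of $\xi_\gamma:\gamma\to\mathbb{C}$ if $V^h|_\gamma=\xi_\gamma$, $L^hV^h$ has finite support, and either $V^h$ is finitely supported or $V^h=G^h\ast(L^hV^h)$. For such $V^h$, $$P^h\xi_\gamma=V^h-G^h\ast[(L^hV^h)\mathbf 1_{M^+}],\qquad Q^h\xi_\gamma=V^h-G^h\ast[(L^hV^h)\mathbf 1_{M^-}].$$ *)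

theory Defs
  imports "HOL-Analysis.Analysis" "Jordan_Normal_Form.Gauss_Jordan_Elimination"
begin

(* Matrix vectors and matrices are only used with indices from nat; the symbol $ and the inner
   product keep their HOL-Analysis meaning below. *)
no_notation Matrix.vec_index (infixl "$" 100)
no_notation Matrix.scalar_prod (infix "\<bullet>" 70)

text \<open>The node \<open>h m\<close> of the lattice is indexed by \<open>m :: int ^ 'd\<close>.\<close>

definition lattice_node :: "real \<Rightarrow> int ^ 'd \<Rightarrow> real ^ 'd" where
  "lattice_node h m = (\<chi> i. h * real_of_int (m $ i))"

definition unit_steps :: "(int ^ 'd) set" where
  "unit_steps = {e. (\<Sum>i\<in>UNIV. \<bar>e $ i\<bar>) = 1}"

definition helmholtz :: "real \<Rightarrow> real \<Rightarrow> (int ^ 'd \<Rightarrow> complex) \<Rightarrow> int ^ 'd \<Rightarrow> complex" where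
  "helmholtz h k v m =
     - (1 / of_real (h\<^sup>2)) * (\<Sum>e\<in>unit_steps. v (m + e) - v m) - of_real (k\<^sup>2) * v m"

text \<open>A bounded domain whose boundary is locally the graph of a Lipschitz function: near each
  boundary point \<open>x\<close> the domain is the part of a ball lying above the graph of \<open>\<phi>\<close>, where
  \<open>\<nu>\<close> is the vertical direction and \<open>\<phi>\<close> is a function on the hyperplane orthogonal to \<open>\<nu>\<close>.\<close>

definition bounded_lipschitz_domain :: "(real ^ 'd) set \<Rightarrow> bool" where
  "bounded_lipschitz_domain \<Omega> \<longleftrightarrow>
     open \<Omega> \<and> connected \<Omega> \<and> \<Omega> \<noteq> {} \<and> bounded \<Omega> \<and>
     (\<forall>x\<in>frontier \<Omega>. \<exists>r>0. \<exists>\<nu> C. \<exists>\<phi> :: real ^ 'd \<Rightarrow> real.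
        norm \<nu> = 1 \<and> C-lipschitz_on {y. y \<bullet> \<nu> = 0} \<phi> \<and>
        \<Omega> \<inter> ball x r = {y \<in> ball x r. y \<bullet> \<nu> > \<phi> (y - (y \<bullet> \<nu>) *\<^sub>R \<nu>)})"

definition M_plus :: "real \<Rightarrow> (real ^ 'd) set \<Rightarrow> (int ^ 'd) set" where
  "M_plus h \<Omega> = {m. lattice_node h m \<in> \<Omega>}"

definition M_minus :: "real \<Rightarrow> (real ^ 'd) set \<Rightarrow> (int ^ 'd) set" where
  "M_minus h \<Omega> = {m. lattice_node h m \<notin> closure \<Omega>}"

definition stencil_nodes :: "(int ^ 'd) set \<Rightarrow> (int ^ 'd) set" where
  "stencil_nodes M = M \<union> {m + e | m e. m \<in> M \<and> e \<in> unit_steps}"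

definition N_plus :: "real \<Rightarrow> (real ^ 'd) set \<Rightarrow> (int ^ 'd) set" where
  "N_plus h \<Omega> = stencil_nodes (M_plus h \<Omega>)"

definition N_minus :: "real \<Rightarrow> (real ^ 'd) set \<Rightarrow> (int ^ 'd) set" where
  "N_minus h \<Omega> = stencil_nodes (M_minus h \<Omega>)"

definition strip :: "real \<Rightarrow> (real ^ 'd) set \<Rightarrow> (int ^ 'd) set" where
  "strip h \<Omega> = N_plus h \<Omega> \<inter> N_minus h \<Omega>"

definition strip_plus :: "real \<Rightarrow> (real ^ 'd) set \<Rightarrow> (int ^ 'd) set" where
  "strip_plus h \<Omega> = strip h \<Omega> \<inter> M_plus h \<Omega>"

definition strip_minus :: "real \<Rightarrow> (real ^ 'd) set \<Rightarrow> (int ^ 'd) set" where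
  "strip_minus h \<Omega> = strip h \<Omega> \<inter> M_minus h \<Omega>"

text \<open>Grid functions are total; a function on a subset of the lattice is represented by any total
  function, of which only the values on that subset matter.  The stencil of a node in
  \<open>M_plus h \<Omega>\<close> lies in \<open>N_plus h \<Omega>\<close>.\<close>

definition nonresonant :: "real \<Rightarrow> real \<Rightarrow> (real ^ 'd) set \<Rightarrow> bool" where
  "nonresonant h k \<Omega> \<longleftrightarrow>
     (\<forall>u. (\<forall>m\<in>M_plus h \<Omega>. helmholtz h k u m = 0) \<and> (\<forall>m\<in>strip h \<Omega>. u m = 0)
        \<longrightarrow> (\<forall>m\<in>N_plus h \<Omega>. u m = 0))"

definition restrict_to :: "(int ^ 'd) set \<Rightarrow> (int ^ 'd \<Rightarrow> complex) \<Rightarrow> int ^ 'd \<Rightarrow> complex" where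
  "restrict_to A f = (\<lambda>m. f m * indicator A m)"

definition symbol :: "real ^ 'd \<Rightarrow> real" where
  "symbol \<theta> = (\<Sum>j\<in>UNIV. 2 * (1 - cos (\<theta> $ j)))"

definition green_reg :: "real \<Rightarrow> real \<Rightarrow> real \<Rightarrow> int ^ 'd \<Rightarrow> complex" where
  "green_reg h k \<epsilon> m =
     1 / of_real ((2 * pi) ^ CARD('d)) *
     integral (cbox (\<chi> i. - pi) (\<chi> i. pi) :: (real ^ 'd) set)
       (\<lambda>\<theta>. exp (\<i> * of_real (\<Sum>j\<in>UNIV. real_of_int (m $ j) * \<theta> $ j)) /
             (of_real (symbol \<theta> - k\<^sup>2 * h\<^sup>2) + \<i> * of_real \<epsilon>))"

definition green :: "real \<Rightarrow> real \<Rightarrow> int ^ 'd \<Rightarrow> complex" where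
  "green h k m = Lim (at_right 0) (\<lambda>\<epsilon>. green_reg h k \<epsilon> m)"

text \<open>Convolution with the Green's function; meaningful for finitely supported \<open>f\<close>.\<close>

definition green_conv :: "real \<Rightarrow> real \<Rightarrow> (int ^ 'd \<Rightarrow> complex) \<Rightarrow> int ^ 'd \<Rightarrow> complex" where
  "green_conv h k f m = of_real (h\<^sup>2) * (\<Sum>n | f n \<noteq> 0. green h k (m - n) * f n)"

definition admissible_extension ::
  "real \<Rightarrow> real \<Rightarrow> (real ^ 'd) set \<Rightarrow> (int ^ 'd \<Rightarrow> complex) \<Rightarrow> (int ^ 'd \<Rightarrow> complex) \<Rightarrow> bool" where
  "admissible_extension h k \<Omega> \<xi> V \<longleftrightarrow>
     (\<forall>m\<in>strip h \<Omega>. V m = \<xi> m) \<and>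
     finite {m. helmholtz h k V m \<noteq> 0} \<and>
     (finite {m. V m \<noteq> 0} \<or> V = green_conv h k (helmholtz h k V))"

text \<open>The potentials with density \<open>\<xi>\<close>, formed from an admissible extension \<open>V\<close> of \<open>\<xi>\<close>; the
  defining formulas refer to \<open>\<xi>\<close> only through \<open>V\<close>.\<close>

definition P_potential ::
  "real \<Rightarrow> real \<Rightarrow> (real ^ 'd) set \<Rightarrow> (int ^ 'd \<Rightarrow> complex) \<Rightarrow> int ^ 'd \<Rightarrow> complex" where
  "P_potential h k \<Omega> V =
     (\<lambda>m. V m - green_conv h k (restrict_to (M_plus h \<Omega>) (helmholtz h k V)) m)"

definition Q_potential ::
  "real \<Rightarrow> real \<Rightarrow> (real ^ 'd) set \<Rightarrow> (int ^ 'd \<Rightarrow> complex) \<Rightarrow> int ^ 'd \<Rightarrow> complex" where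
  "Q_potential h k \<Omega> V =
     (\<lambda>m. V m - green_conv h k (restrict_to (M_minus h \<Omega>) (helmholtz h k V)) m)"

definition shielding_control ::
  "real \<Rightarrow> real \<Rightarrow> (real ^ 'd) set \<Rightarrow> (int ^ 'd \<Rightarrow> complex) \<Rightarrow> int ^ 'd \<Rightarrow> complex" where
  "shielding_control h k \<Omega> V = (\<lambda>m. - restrict_to (M_minus h \<Omega>) (helmholtz h k V) m)"

definition confinement_control ::
  "real \<Rightarrow> real \<Rightarrow> (real ^ 'd) set \<Rightarrow> (int ^ 'd \<Rightarrow> complex) \<Rightarrow> int ^ 'd \<Rightarrow> complex" where
  "confinement_control h k \<Omega> V = (\<lambda>m. - restrict_to (M_plus h \<Omega>) (helmholtz h k V) m)"

text \<open>The nodes of the strip are numbered by a list \<open>gs\<close> without repetitions.\<close>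

definition S_matrix :: "real \<Rightarrow> real \<Rightarrow> (int ^ 'd) list \<Rightarrow> complex mat" where
  "S_matrix h k gs = mat (length gs) (length gs)
     (\<lambda>(i, j). of_real (h\<^sup>2) * green h k (gs ! i - gs ! j))"

text \<open>The vector \<open>S\<inverse> \<xi>\<close>, as a grid function vanishing away from the listed nodes.\<close>

definition layer_density ::
  "real \<Rightarrow> real \<Rightarrow> (int ^ 'd) list \<Rightarrow> (int ^ 'd \<Rightarrow> complex) \<Rightarrow> int ^ 'd \<Rightarrow> complex" where
  "layer_density h k gs \<xi> m =
     (\<Sum>i<length gs. if gs ! i = m
        then vec_index (the (mat_inverse (S_matrix h k gs)) *\<^sub>v
                        Matrix.vec (length gs) (\<lambda>j. \<xi> (gs ! j))) i
        else 0)"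

end

theory Submission
  imports Defs
begin

text \<open>
  For \<open>\<epsilon> > 0\<close> the discrete Helmholtz operator acts on a character by multiplication with
  \<open>(\<sigma> - k\<^sup>2h\<^sup>2) / h\<^sup>2\<close>, so applied to the regularised Green's function it cancels the
  denominator up to an error: it gives \<open>h\<^sup>-\<^sup>2\<close> times \<open>\<delta> - i\<epsilon>G\<^sub>\<epsilon>\<close>.  Since
  \<open>G\<^sub>\<epsilon>\<close> converges, the error vanishes in the limit and \<open>G\<close> is a fundamental solution; hence
  \<open>L(G * \<lambda>) = \<lambda>\<close>.  As no node lies on the boundary, \<open>\<lambda>\<close> splits as
  \<open>\<lambda>\<^sup>+ + \<lambda>\<^sup>-\<close>, and the formulas for the potentials follow by linearity of \<open>G * -\<close>.
\<close>

section \<open>Integrals of Fourier modes over the torus cell\<close>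

lemma Basis_real_vec_eq: "(Basis :: (real ^ 'd) set) = range (\<lambda>i. axis i 1)"
  by (auto simp: Basis_vec_def)

lemma inj_axis: "c \<noteq> 0 \<Longrightarrow> inj (\<lambda>i. axis i c)"
  by (auto simp: inj_on_def axis_eq_axis)

text \<open>This is Fubini for a product of functions of one coordinate each. Extending every factor
  by zero outside its interval turns the box integral into an integral over the whole space, where
  Lebesgue measure is a product measure.\<close>

lemma integral_cbox_prod:
  fixes f :: "'d::finite \<Rightarrow> real \<Rightarrow> complex"
  assumes cont: "\<And>i. continuous_on {a $ i..b $ i} (f i)"
  shows "integral (cbox a b) (\<lambda>x. \<Prod>i\<in>UNIV. f i (x $ i)) = (\<Prod>i\<in>UNIV. integral {a $ i..b $ i} (f i))"
proof -
  define F where "F i t = indicator {a $ i..b $ i} t *\<^sub>R f i t" for i t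
  have F_int: "integrable lborel (F i)" for i
    unfolding F_def[abs_def] using borel_integrable_compact[OF _ cont] by simp
  hence [measurable]: "F i \<in> borel_measurable borel" for i
    using borel_measurable_integrable by fastforce
  \<comment> \<open>The product measure is indexed by basis vectors rather than by coordinates;
    \<open>ix\<close> recovers the coordinate from the basis vector.\<close>
  define ix where "ix = the_inv_into UNIV (\<lambda>i::'d. axis i (1::real))"
  have ix [simp]: "ix (axis i 1) = i" for i
    unfolding ix_def by (rule the_inv_into_f_f) (auto simp: inj_axis)
  have F_integral: "integral\<^sup>L lborel (F i) = integral {a $ i..b $ i} (f i)" for i
    using set_borel_integral_eq_integral(2)[of "{a $ i..b $ i}" "f i"] F_int[of i]
    by (simp add: F_def[abs_def] set_lebesgue_integral_def set_integrable_def)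
  \<comment> \<open>Continuity on the compact box gives Lebesgue integrability, so that the gauge
    integral agrees with the Bochner integral.\<close>
  have "continuous_on (cbox a b) (\<lambda>x. \<Prod>i\<in>UNIV. f i (x $ i))"
  proof (rule continuous_on_prod)
    fix i :: 'd
    show "continuous_on (cbox a b) (\<lambda>x. f i (x $ i))"
    proof (rule continuous_on_compose2[OF cont[of i], where f = "\<lambda>x. x $ i"])
      show "continuous_on (cbox a b) (\<lambda>x. x $ i)" by (intro continuous_intros)
    qed (auto simp: mem_box_cart)
  qed
  hence "set_integrable lborel (cbox a b) (\<lambda>x. \<Prod>i\<in>UNIV. f i (x $ i))"
    unfolding set_integrable_def by (rule borel_integrable_compact[OF compact_cbox])
  hence "integral (cbox a b) (\<lambda>x. \<Prod>i\<in>UNIV. f i (x $ i)) =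
      (\<integral>x. indicator (cbox a b) x *\<^sub>R (\<Prod>i\<in>UNIV. f i (x $ i)) \<partial>lborel)"
    by (rule set_borel_integral_eq_integral(2)[unfolded set_lebesgue_integral_def, symmetric])
  also have "\<dots> = (\<integral>x. (\<Prod>i\<in>UNIV. F i (x $ i)) \<partial>lborel)"
  proof (rule Bochner_Integration.integral_cong[OF refl])
    fix x :: "real ^ 'd"
    show "indicator (cbox a b) x *\<^sub>R (\<Prod>i\<in>UNIV. f i (x $ i)) = (\<Prod>i\<in>UNIV. F i (x $ i))"
    proof (cases "x \<in> cbox a b")
      case True
      thus ?thesis by (auto simp: F_def mem_box_cart intro!: prod.cong)
    next
      case False
      then obtain i where "F i (x $ i) = 0"
        by (auto simp: F_def mem_box_cart indicator_def)
      thus ?thesis using False by (auto intro!: prod_zero[symmetric])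
    qed
  qed
  \<comment> \<open>\<open>lborel\<close> is by definition the image of the product measure under
    the map from coefficients to linear combinations of the basis.\<close>
  also have "\<dots> = (\<integral>y. (\<Prod>i\<in>UNIV. F i ((\<Sum>b\<in>Basis. y b *\<^sub>R b) $ i)) \<partial>(\<Pi>\<^sub>M b\<in>(Basis::(real ^ 'd) set). lborel))"
    by (subst lborel_eq, subst integral_distr) auto
  also have "\<dots> = (\<integral>y. (\<Prod>b\<in>Basis. F (ix b) (y b)) \<partial>(\<Pi>\<^sub>M b\<in>(Basis::(real ^ 'd) set). lborel))"
  proof (rule Bochner_Integration.integral_cong[OF refl])
    fix y :: "real ^ 'd \<Rightarrow> real"
    have "(\<Sum>b\<in>Basis. y b *\<^sub>R b) $ i = y (axis i 1)" for i
    proof -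
      have "(\<Sum>b\<in>Basis. y b *\<^sub>R b) $ i = (\<Sum>b\<in>Basis. y b *\<^sub>R b) \<bullet> axis i 1"
        by (simp add: inner_axis)
      also have "\<dots> = y (axis i 1)"
        by (rule inner_sum_left_Basis) (auto simp: Basis_real_vec_eq)
      finally show ?thesis .
    qed
    thus "(\<Prod>i\<in>UNIV. F i ((\<Sum>b\<in>Basis. y b *\<^sub>R b) $ i)) = (\<Prod>b\<in>Basis. F (ix b) (y b))"
      by (simp add: Basis_real_vec_eq prod.reindex inj_axis)
  qed
  also have "\<dots> = (\<Prod>b\<in>(Basis::(real ^ 'd) set). integral\<^sup>L lborel (F (ix b)))"
  proof -
    interpret product_sigma_finite "\<lambda>_::real ^ 'd. lborel::real measure" ..
    show ?thesis by (rule product_integral_prod) (auto simp: F_int)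
  qed
  also have "\<dots> = (\<Prod>i\<in>UNIV. integral {a $ i..b $ i} (f i))"
    by (simp add: Basis_real_vec_eq prod.reindex inj_axis F_integral)
  finally show ?thesis .
qed

text \<open>For \<open>n = 0\<close> the integrand is 1. Otherwise the antiderivative takes the same
  value at both ends by periodicity.\<close>

lemma integral_exp_int:
  "integral {-pi..pi} (\<lambda>t. exp (\<i> * of_real (real_of_int n * t))) = (if n = 0 then of_real (2 * pi) else 0)"
proof (cases "n = 0")
  case False
  let ?F = "\<lambda>t::real. exp (\<i> * of_real (real_of_int n * t)) / (\<i> * of_int n)"
  have F: "((\<lambda>t. exp (\<i> * of_real (real_of_int n * t))) has_integral ?F pi - ?F (- pi)) {-pi..pi}"
  proof (rule fundamental_theorem_of_calculus)
    fix x :: real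
    have "((\<lambda>z. exp (\<i> * (of_int n * z)) / (\<i> * of_int n)) has_field_derivative
        exp (\<i> * (of_int n * of_real x))) (at (of_real x))"
      using False by (auto intro!: derivative_eq_intros simp: field_simps)
    from has_vector_derivative_real_field[OF this]
    show "(?F has_vector_derivative exp (\<i> * of_real (real_of_int n * x))) (at x within {-pi..pi})"
      by simp
  qed simp
  \<comment> \<open>The two exponents differ by \<open>n\<close> full periods of \<open>exp\<close>,
    which is where the witness \<open>n\<close> comes from.\<close>
  have "exp (\<i> * of_real (real_of_int n * pi)) = exp (\<i> * of_real (real_of_int n * - pi))"
    unfolding exp_eq by (auto intro!: exI[of _ n] simp: algebra_simps)
  with F False show ?thesis by (simp add: integral_unique)
qed (simp add: scaleR_conv_of_real)

text \<open>The numerator of the integrand of \<open>green_reg\<close>, that is, the Fourier mode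
  that diagonalises translation-invariant operators on the lattice.\<close>

definition character :: "int ^ 'd \<Rightarrow> real ^ 'd \<Rightarrow> complex" where
  "character m \<theta> = exp (\<i> * of_real (\<Sum>j\<in>UNIV. real_of_int (m $ j) * \<theta> $ j))"

definition torus_cell :: "(real ^ 'd) set" where
  "torus_cell = cbox (\<chi> i. - pi) (\<chi> i. pi)"

text \<open>Orthogonality of characters: the exponential of a sum factors over the coordinates, and
  a single nonzero coordinate of \<open>m\<close> makes the product of the integrals vanish.\<close>

lemma integral_character:
  "integral torus_cell (character (m :: int ^ 'd)) = (if m = 0 then of_real ((2 * pi) ^ CARD('d)) else 0)"
proof -
  have "character m = (\<lambda>\<theta>. \<Prod>j\<in>UNIV. exp (\<i> * of_real (real_of_int (m $ j) * \<theta> $ j)))"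
    by (simp add: fun_eq_iff character_def sum_distrib_left exp_sum)
  hence "integral torus_cell (character m) = (\<Prod>j\<in>UNIV. if m $ j = 0 then of_real (2 * pi) else 0)"
    unfolding torus_cell_def
    by (simp only: integral_cbox_prod)
       (subst integral_cbox_prod; auto intro!: continuous_intros prod.cong simp: integral_exp_int[simplified])
  also have "\<dots> = (if m = 0 then of_real ((2 * pi) ^ CARD('d)) else 0)"
    by (auto simp: Finite_Cartesian_Product.vec_eq_iff prod_zero_iff)
  finally show ?thesis .
qed

section \<open>The stencil and its action on characters\<close>

text \<open>One nonzero integer entry already exhausts an l1 norm of 1, so it is 1 or -1 and all
  other entries vanish.\<close>

lemma unit_steps_eq:
  "(unit_steps :: (int ^ 'd) set) = range (\<lambda>i. axis i 1) \<union> range (\<lambda>i. axis i (- 1))"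
proof (intro Set.equalityI subsetI)
  fix e :: "int ^ 'd"
  assume "e \<in> unit_steps"
  hence s: "(\<Sum>i\<in>UNIV. \<bar>e $ i\<bar>) = 1" by (simp add: unit_steps_def)
  then obtain i where i: "e $ i \<noteq> 0"
    by (metis (no_types, lifting) abs_0 sum.neutral zero_neq_one)
  have split: "(\<Sum>j\<in>UNIV. \<bar>e $ j\<bar>) = \<bar>e $ i\<bar> + (\<Sum>j\<in>UNIV - {i}. \<bar>e $ j\<bar>)"
    by (rule sum.remove) auto
  have "0 \<le> (\<Sum>j\<in>UNIV - {i}. \<bar>e $ j\<bar>)" by (rule sum_nonneg) auto
  with s split i have 1: "\<bar>e $ i\<bar> = 1" and "(\<Sum>j\<in>UNIV - {i}. \<bar>e $ j\<bar>) = 0" by linarith+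
  hence "\<forall>j\<in>UNIV - {i}. \<bar>e $ j\<bar> = 0" by (subst sum_nonneg_eq_0_iff[symmetric]) auto
  hence "e $ j = axis i (e $ i) $ j" for j by (cases "j = i") (auto simp: axis_def)
  hence "e = axis i (e $ i)" unfolding Finite_Cartesian_Product.vec_eq_iff by blast
  moreover have "e $ i = 1 \<or> e $ i = - 1" using 1 by linarith
  ultimately show "e \<in> range (\<lambda>i. axis i 1) \<union> range (\<lambda>i. axis i (- 1))"
    by force
next
  have "(\<Sum>i\<in>UNIV. \<bar>axis j c $ i\<bar>) = \<bar>c\<bar>" for j :: 'd and c :: int
    by (simp add: axis_def if_distrib sum.delta cong: if_cong)
  thus "e \<in> unit_steps" if "e \<in> range (\<lambda>i. axis i 1) \<union> range (\<lambda>i. axis i (- 1))" for e :: "int ^ 'd"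
    using that by (auto simp: unit_steps_def)
qed

lemma finite_unit_steps: "finite (unit_steps :: (int ^ 'd) set)"
  by (simp add: unit_steps_eq)

lemma sum_unit_steps:
  fixes f :: "int ^ 'd \<Rightarrow> 'a::comm_monoid_add"
  shows "(\<Sum>e\<in>unit_steps. f e) = (\<Sum>i\<in>UNIV. f (axis i 1) + f (axis i (- 1)))"
proof -
  have "range (\<lambda>i::'d. axis i (1::int)) \<inter> range (\<lambda>i. axis i (- 1)) = {}"
    by (auto simp: axis_eq_axis)
  thus ?thesis
    by (simp add: unit_steps_eq sum.union_disjoint sum.reindex inj_axis sum.distrib)
qed

lemma character_add: "character (m + n) \<theta> = character m \<theta> * character n \<theta>"
  by (simp add: character_def sum.distrib algebra_simps flip: exp_add)

lemma character_axis: "character (axis i c) \<theta> = exp (\<i> * of_real (real_of_int c * \<theta> $ i))"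
proof -
  have "(\<Sum>j\<in>UNIV. real_of_int (axis i c $ j) * \<theta> $ j) = (\<Sum>j\<in>UNIV. if j = i then real_of_int c * \<theta> $ i else 0)"
    by (rule sum.cong) (auto simp: axis_def)
  thus ?thesis by (simp add: character_def)
qed

text \<open>Characters are eigenfunctions of the stencil sum: each pair of opposite steps
  contributes \<open>2 * cos (\<theta> $ i) - 2\<close>, and these add up to minus the
  symbol.\<close>

lemma sum_unit_steps_character:
  "(\<Sum>e\<in>unit_steps. character (m + e) \<theta> - character m \<theta>) = - (of_real (symbol \<theta>) * character m \<theta>)"
proof -
  have *: "character (axis i 1) \<theta> + character (axis i (- 1)) \<theta> = 2 * of_real (cos (\<theta> $ i))" for i
    using cos_exp_eq[of "of_real (\<theta> $ i)"] by (simp add: character_axis cos_of_real[symmetric] mult.commute)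
  have "(\<Sum>e\<in>unit_steps. character (m + e) \<theta> - character m \<theta>) =
      (\<Sum>i\<in>UNIV. character m \<theta> * (character (axis i 1) \<theta> + character (axis i (- 1)) \<theta> - 2))"
    unfolding sum_unit_steps by (intro sum.cong) (auto simp: character_add algebra_simps)
  also have "\<dots> = - (of_real (symbol \<theta>) * character m \<theta>)"
    unfolding * by (simp add: symbol_def sum_distrib_left sum_distrib_right sum_negf[symmetric] algebra_simps)
  finally show ?thesis .
qed


section \<open>The Green's function as a fundamental solution\<close>

lemma continuous_on_character: "continuous_on S (character m)"
  unfolding character_def by (intro continuous_intros)

lemma continuous_on_symbol: "continuous_on S symbol"
  unfolding symbol_def by (intro continuous_intros)

text \<open>The denominator has imaginary part \<epsilon> and hence no zero, so the integrand is
  continuous and the finite stencil sum may be taken under the integral. There the identity holds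
  pointwise in \<theta>, and orthogonality of characters produces the delta term.\<close>

lemma helmholtz_green_reg:
  fixes m :: "int ^ 'd"
  assumes "h \<noteq> 0" and "\<epsilon> \<noteq> 0"
  shows "helmholtz h k (green_reg h k \<epsilon>) m =
    ((if m = 0 then 1 else 0) - \<i> * of_real \<epsilon> * green_reg h k \<epsilon> m) / of_real (h\<^sup>2)"
proof -
  define c :: complex where "c = 1 / of_real ((2 * pi) ^ CARD('d))"
  define D :: "real ^ 'd \<Rightarrow> complex"
    where "D \<theta> = of_real (symbol \<theta> - k\<^sup>2 * h\<^sup>2) + \<i> * of_real \<epsilon>" for \<theta>
  have D: "D \<theta> \<noteq> 0" for \<theta>
    using \<open>\<epsilon> \<noteq> 0\<close> by (simp add: D_def complex_eq_iff)
  have G: "((\<lambda>\<theta>. c * (character n \<theta> / D \<theta>)) has_integral green_reg h k \<epsilon> n) torus_cell" for n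
  proof -
    have "continuous_on torus_cell (\<lambda>\<theta>. character n \<theta> / D \<theta>)"
      using D unfolding D_def
      by (intro continuous_intros continuous_on_character continuous_on_symbol) auto
    hence "(\<lambda>\<theta>. character n \<theta> / D \<theta>) integrable_on torus_cell"
      unfolding torus_cell_def by (rule integrable_continuous)
    from has_integral_mult_right[OF integrable_integral[OF this], of c] show ?thesis
      by (simp add: green_reg_def c_def D_def character_def torus_cell_def)
  qed
  have delta: "((\<lambda>\<theta>. c * character m \<theta>) has_integral (if m = 0 then 1 else 0)) torus_cell"
  proof -
    have "character m integrable_on torus_cell"
      unfolding torus_cell_def by (rule integrable_continuous[OF continuous_on_character])
    from has_integral_mult_right[OF integrable_integral[OF this], of c] show ?thesis
      by (auto simp: integral_character c_def split: if_splits)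
  qed
  have eq: "- (1 / of_real (h\<^sup>2)) *
        (\<Sum>e\<in>unit_steps. c * (character (m + e) \<theta> / D \<theta>) - c * (character m \<theta> / D \<theta>)) -
        of_real (k\<^sup>2) * (c * (character m \<theta> / D \<theta>)) =
      1 / of_real (h\<^sup>2) * (c * character m \<theta> - \<i> * of_real \<epsilon> * (c * (character m \<theta> / D \<theta>)))" for \<theta>
  proof -
    have "(\<Sum>e\<in>unit_steps. c * (character (m + e) \<theta> / D \<theta>) - c * (character m \<theta> / D \<theta>)) =
        c / D \<theta> * (\<Sum>e\<in>unit_steps. character (m + e) \<theta> - character m \<theta>)"
      by (simp add: sum_distrib_left algebra_simps diff_divide_distrib)
    also have "\<dots> = - (c / D \<theta> * of_real (symbol \<theta>) * character m \<theta>)"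
      by (simp add: sum_unit_steps_character)
    \<comment> \<open>Of the three terms, the first cancels the denominator and leaves the bare
      character, the second cancels the zeroth-order term of the operator, and the third is the
      remainder of order \<epsilon>.\<close>
    also have "of_real (symbol \<theta>) = D \<theta> + of_real k ^ 2 * of_real h ^ 2 - \<i> * of_real \<epsilon>"
      by (simp add: D_def)
    finally show ?thesis
      using \<open>h \<noteq> 0\<close> D[of \<theta>] by (simp add: field_simps)
  qed
  have "((\<lambda>\<theta>. - (1 / of_real (h\<^sup>2)) *
        (\<Sum>e\<in>unit_steps. c * (character (m + e) \<theta> / D \<theta>) - c * (character m \<theta> / D \<theta>)) -
        of_real (k\<^sup>2) * (c * (character m \<theta> / D \<theta>)))
      has_integral helmholtz h k (green_reg h k \<epsilon>) m) torus_cell"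
    unfolding helmholtz_def
    by (intro has_integral_diff has_integral_mult_right has_integral_sum G finite_unit_steps)
  moreover have "((\<lambda>\<theta>. 1 / of_real (h\<^sup>2) *
        (c * character m \<theta> - \<i> * of_real \<epsilon> * (c * (character m \<theta> / D \<theta>))))
      has_integral 1 / of_real (h\<^sup>2) *
        ((if m = 0 then 1 else 0) - \<i> * of_real \<epsilon> * green_reg h k \<epsilon> m)) torus_cell"
    by (intro has_integral_diff has_integral_mult_right G delta)
  ultimately show ?thesis
    unfolding eq by (simp add: has_integral_unique)
qed

text \<open>The operator involves finitely many nodes, so it commutes with the limit; the remainder
  tends to zero because \<epsilon> is multiplied by a convergent quantity.\<close>

lemma helmholtz_green:
  fixes m :: "int ^ 'd"
  assumes "h \<noteq> 0"
    and ex_lim: "\<And>m :: int ^ 'd. \<exists>l. ((\<lambda>\<epsilon>. green_reg h k \<epsilon> m) \<longlongrightarrow> l) (at_right 0)"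
  shows "helmholtz h k (green h k) m = (if m = 0 then 1 / of_real (h\<^sup>2) else 0)"
proof -
  \<comment> \<open>\<open>Lim\<close> is meaningful only when a limit exists; the existence
    assumption makes \<open>green\<close> the actual limit.\<close>
  have lim: "((\<lambda>\<epsilon>. green_reg h k \<epsilon> n) \<longlongrightarrow> green h k n) (at_right 0)" for n :: "int ^ 'd"
    using ex_lim[of n] tendsto_Lim[OF trivial_limit_at_right_real] unfolding green_def by blast
  have "((\<lambda>\<epsilon>. helmholtz h k (green_reg h k \<epsilon>) m) \<longlongrightarrow> helmholtz h k (green h k) m) (at_right 0)"
    unfolding helmholtz_def by (intro tendsto_intros lim)
  moreover have "((\<lambda>\<epsilon>. helmholtz h k (green_reg h k \<epsilon>) m) \<longlongrightarrow>
      ((if m = 0 then 1 else 0) - \<i> * of_real 0 * green h k m) / of_real (h\<^sup>2)) (at_right 0)"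
  proof (rule Lim_transform_eventually)
    show "((\<lambda>\<epsilon>. ((if m = 0 then 1 else 0) - \<i> * of_real \<epsilon> * green_reg h k \<epsilon> m) / of_real (h\<^sup>2)) \<longlongrightarrow>
      ((if m = 0 then 1 else 0) - \<i> * of_real 0 * green h k m) / of_real (h\<^sup>2)) (at_right 0)"
      using \<open>h \<noteq> 0\<close> by (intro tendsto_intros lim) auto
    \<comment> \<open>The formula for the regularised function requires a nonzero \<epsilon>, which
      holds throughout the right-sided filter.\<close>
    show "\<forall>\<^sub>F \<epsilon> in at_right 0. ((if m = 0 then 1 else 0) - \<i> * of_real \<epsilon> * green_reg h k \<epsilon> m) / of_real (h\<^sup>2) =
        helmholtz h k (green_reg h k \<epsilon>) m"
      using eventually_at_right_less[of 0]
      by eventually_elim (simp add: helmholtz_green_reg \<open>h \<noteq> 0\<close>)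
  qed
  ultimately have "helmholtz h k (green h k) m =
      ((if m = 0 then 1 else 0) - \<i> * of_real 0 * green h k m) / of_real (h\<^sup>2)"
    by (rule tendsto_unique[OF trivial_limit_at_right_real])
  thus ?thesis by simp
qed

section \<open>Linearity of the operator and of the convolution\<close>

lemma helmholtz_zero: "helmholtz h k (\<lambda>m. 0) m = 0"
  by (simp add: helmholtz_def)

lemma helmholtz_add: "helmholtz h k (\<lambda>m. u m + v m) m = helmholtz h k u m + helmholtz h k v m"
  by (simp add: helmholtz_def sum.distrib sum_subtractf algebra_simps)

lemma helmholtz_cmult: "helmholtz h k (\<lambda>m. c * u m) m = c * helmholtz h k u m"
  by (simp add: helmholtz_def sum_distrib_left right_diff_distrib mult.left_commute[of c])

lemma helmholtz_sum: "helmholtz h k (\<lambda>m. \<Sum>n\<in>A. u n m) m = (\<Sum>n\<in>A. helmholtz h k (u n) m)"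
  by (induction A rule: infinite_finite_induct) (simp_all add: helmholtz_zero helmholtz_add)

lemma helmholtz_translate: "helmholtz h k (\<lambda>m. u (m - n)) m = helmholtz h k u (m - n)"
  by (simp add: helmholtz_def add_diff_eq diff_add_eq)

text \<open>\<open>green_conv\<close> sums over the exact support of its density. Passing to a
  larger finite set lets densities with different supports share one index set.\<close>

lemma green_conv_superset:
  assumes "finite A" and "\<And>n. n \<notin> A \<Longrightarrow> f n = 0"
  shows "green_conv h k f m = of_real (h\<^sup>2) * (\<Sum>n\<in>A. green h k (m - n) * f n)"
proof -
  have "(\<Sum>n | f n \<noteq> 0. green h k (m - n) * f n) = (\<Sum>n\<in>A. green h k (m - n) * f n)"
    using assms by (intro sum.mono_neutral_left) auto
  thus ?thesis by (simp add: green_conv_def)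
qed

text \<open>The convolution is a finite combination of translates of the fundamental solution; the
  factor \<open>h\<^sup>2\<close> cancels the weight of the delta, and only the term
  \<open>n = m\<close> survives.\<close>

lemma helmholtz_green_conv:
  fixes f :: "int ^ 'd \<Rightarrow> complex"
  assumes "h \<noteq> 0"
    and "\<And>m :: int ^ 'd. \<exists>l. ((\<lambda>\<epsilon>. green_reg h k \<epsilon> m) \<longlongrightarrow> l) (at_right 0)"
    and "finite {n. f n \<noteq> 0}"
  shows "helmholtz h k (green_conv h k f) = f"
proof
  fix m
  have "helmholtz h k (green_conv h k f) m =
      of_real (h\<^sup>2) * (\<Sum>n | f n \<noteq> 0. f n * helmholtz h k (green h k) (m - n))"
    unfolding green_conv_def[abs_def]
    by (simp add: helmholtz_cmult helmholtz_sum helmholtz_translate mult.commute[of _ "f _"])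
  also have "\<dots> = (\<Sum>n | f n \<noteq> 0. if n = m then f n else 0)"
    using \<open>h \<noteq> 0\<close> unfolding sum_distrib_left
    by (intro sum.cong) (auto simp: helmholtz_green[OF assms(1,2)])
  also have "\<dots> = f m"
    using assms(3) by simp
  finally show "helmholtz h k (green_conv h k f) m = f m" .
qed

lemma green_conv_diff:
  assumes "finite {n. f n \<noteq> 0}" and "finite {n. g n \<noteq> 0}"
  shows "green_conv h k (\<lambda>n. f n - g n) m = green_conv h k f m - green_conv h k g m"
proof -
  let ?A = "{n. f n \<noteq> 0} \<union> {n. g n \<noteq> 0}"
  have "finite ?A" using assms by simp
  note superset = green_conv_superset[OF this]
  show ?thesis
    by (subst (1 2 3) superset) (auto simp: right_diff_distrib sum_subtractf)
qed

lemma green_conv_uminus: "green_conv h k (\<lambda>n. - f n) = (\<lambda>m. - green_conv h k f m)"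
  by (simp add: fun_eq_iff green_conv_def sum_negf)

section \<open>The inverse of the single-layer matrix and its density\<close>

text \<open>This links the abstract notion of invertibility to the computed inverse:
  \<open>mat_inverse\<close> returns \<open>None\<close> only for matrices that are not units of the
  matrix ring.\<close>

lemma mat_inverse_invertible:
  fixes A :: "'a::field mat"
  assumes A: "A \<in> carrier_mat n n" and "invertible_mat A"
  shows "the (mat_inverse A) \<in> carrier_mat n n" and "A * the (mat_inverse A) = 1\<^sub>m n"
proof -
  from assms obtain B where B: "A * B = 1\<^sub>m n" "B * A = 1\<^sub>m (dim_row B)"
    by (auto simp: invertible_mat_def inverts_mat_def)
  \<comment> \<open>\<open>invertible_mat\<close> does not state the dimensions of the inverse; they
    are read off from the two product identities.\<close>
  have "dim_col B = n" using B(1) A by (metis index_mult_mat(3) index_one_mat(3))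
  moreover have "dim_row B = n" using B(2) A by (metis carrier_matD(2) index_mult_mat(3) index_one_mat(3))
  ultimately have "B \<in> carrier_mat n n" by auto
  with A B have "A \<in> Units (ring_mat TYPE('a) n ())"
    by (auto simp: Units_def ring_mat_def)
  with mat_inverse(1)[OF A] obtain C where C: "mat_inverse A = Some C" by fastforce
  from mat_inverse(2)[OF A C] C show "the (mat_inverse A) \<in> carrier_mat n n" "A * the (mat_inverse A) = 1\<^sub>m n"
    by auto
qed

lemma layer_density_outside: "m \<notin> set gs \<Longrightarrow> layer_density h k gs \<xi> m = 0"
  by (auto simp: layer_density_def intro!: sum.neutral)

text \<open>Since \<open>gs\<close> has no repetitions, exactly one summand of the density is
  selected at a listed node.\<close>

lemma layer_density_nth:
  assumes "distinct gs" and "i < length gs"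
  shows "layer_density h k gs \<xi> (gs ! i) =
    vec_index (the (mat_inverse (S_matrix h k gs)) *\<^sub>v Matrix.vec (length gs) (\<lambda>j. \<xi> (gs ! j))) i"
proof -
  have "gs ! j = gs ! i \<longleftrightarrow> j = i" if "j < length gs" for j
    using assms that by (simp add: nth_eq_iff_index_eq)
  thus ?thesis using assms(2) unfolding layer_density_def
    by (subst sum.cong[OF refl, where h = "\<lambda>j. if j = i then _ j else 0"]) auto
qed

text \<open>At the listed nodes, convolution with a density supported there is multiplication by
  \<open>S_matrix\<close>, which undoes the inverse used to form the density.\<close>

lemma green_conv_layer_density:
  assumes "distinct gs" and inv: "invertible_mat (S_matrix h k gs)" and "m \<in> set gs"
  shows "green_conv h k (layer_density h k gs \<xi>) m = \<xi> m"
proof -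
  let ?N = "length gs" and ?S = "S_matrix h k gs" and ?lam = "layer_density h k gs \<xi>"
  let ?B = "the (mat_inverse ?S)" and ?x = "Matrix.vec ?N (\<lambda>j. \<xi> (gs ! j))"
  from \<open>m \<in> set gs\<close> obtain i where i: "i < ?N" "m = gs ! i" by (metis in_set_conv_nth)
  have S: "?S \<in> carrier_mat ?N ?N" by (simp add: S_matrix_def)
  note B = mat_inverse_invertible[OF S inv]
  have bij: "bij_betw (\<lambda>j. gs ! j) {..<?N} (set gs)"
    using bij_betw_nth[OF \<open>distinct gs\<close>] by simp
  have "green_conv h k ?lam m = of_real (h\<^sup>2) * (\<Sum>n\<in>set gs. green h k (m - n) * ?lam n)"
    by (rule green_conv_superset) (auto simp: layer_density_outside)
  also have "\<dots> = (\<Sum>j<?N. of_real (h\<^sup>2) * green h k (m - gs ! j) * ?lam (gs ! j))"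
    by (simp add: sum.reindex_bij_betw[OF bij, symmetric] sum_distrib_left mult.assoc)
  also have "\<dots> = (\<Sum>j<?N. ?S $$ (i, j) * vec_index (?B *\<^sub>v ?x) j)"
    using i by (intro sum.cong) (auto simp: S_matrix_def layer_density_nth[OF \<open>distinct gs\<close>])
  also have "\<dots> = vec_index (?S *\<^sub>v (?B *\<^sub>v ?x)) i"
    using i S B(1) by (simp add: Matrix.scalar_prod_def atLeast0LessThan)
  also have "?S *\<^sub>v (?B *\<^sub>v ?x) = (?S * ?B) *\<^sub>v ?x"
    using S B(1) by (intro assoc_mult_mat_vec[symmetric]) auto
  also have "vec_index \<dots> i = \<xi> m"
    using i by (simp add: B(2))
  finally show ?thesis .
qed

section \<open>Potentials and controls generated by the single-layer extension\<close>

theorem theorem4p3: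
  fixes h k :: real
    and \<Omega> :: "(real ^ 'd) set"
    and gs :: "(int ^ 'd) list"
    and \<xi> :: "int ^ 'd \<Rightarrow> complex"
  assumes "CARD('d) = 2 \<or> CARD('d) = 3"
    and "h > 0" and "k > 0"
    and "bounded_lipschitz_domain \<Omega>"
    and "\<forall>m. lattice_node h m \<notin> frontier \<Omega>"
    and "\<forall>m :: int ^ 'd. \<exists>l. ((\<lambda>\<epsilon>. green_reg h k \<epsilon> m) \<longlongrightarrow> l) (at_right 0)"
    and "nonresonant h k \<Omega>"
    and "distinct gs" and "set gs = strip h \<Omega>"
    and "invertible_mat (S_matrix h k gs)"
  shows "let lam = layer_density h k gs \<xi>;
             V = green_conv h k lam;
             lam_plus = restrict_to (strip_plus h \<Omega>) lam;
             lam_minus = restrict_to (strip_minus h \<Omega>) lam;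
             P = P_potential h k \<Omega> V;
             Q = Q_potential h k \<Omega> V;
             g_sh = shielding_control h k \<Omega> V;
             g_conf = confinement_control h k \<Omega> V
         in (\<forall>m\<in>strip h \<Omega>. V m = \<xi> m) \<and>
            helmholtz h k V = lam \<and>
            admissible_extension h k \<Omega> \<xi> V \<and>
            P = green_conv h k lam_minus \<and>
            Q = green_conv h k lam_plus \<and>
            green_conv h k g_sh = (\<lambda>m. - P m) \<and>
            green_conv h k g_conf = (\<lambda>m. - Q m) \<and>
            g_sh = (\<lambda>m. - lam_minus m) \<and>
            g_conf = (\<lambda>m. - lam_plus m)"
proof -
  define lam where "lam = layer_density h k gs \<xi>"
  define V where "V = green_conv h k lam"
  define lam_plus where "lam_plus = restrict_to (strip_plus h \<Omega>) lam"
  define lam_minus where "lam_minus = restrict_to (strip_minus h \<Omega>) lam"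
  have lam_outside: "lam m = 0" if "m \<notin> strip h \<Omega>" for m
    using that layer_density_outside[of m gs] assms(9) by (simp add: lam_def)
  have "finite (strip h \<Omega>)" using assms(9) by (metis List.finite_set)
  hence fin: "finite {m. f m \<noteq> 0}" if "\<And>m. m \<notin> strip h \<Omega> \<Longrightarrow> f m = 0" for f :: "int ^ 'd \<Rightarrow> complex"
    using that by (auto elim!: finite_subset[rotated])
  have fin_lam: "finite {m. lam m \<noteq> 0}" "finite {m. lam_plus m \<noteq> 0}" "finite {m. lam_minus m \<noteq> 0}"
    by (auto intro!: fin simp: lam_outside lam_plus_def lam_minus_def restrict_to_def)
  have trace: "\<forall>m\<in>strip h \<Omega>. V m = \<xi> m"
    using green_conv_layer_density[OF assms(8,10)] assms(9) by (simp add: V_def lam_def)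
  have LV: "helmholtz h k V = lam"
    unfolding V_def using assms(2,6) by (intro helmholtz_green_conv fin_lam(1)) auto
  \<comment> \<open>For an open domain the frontier is the closure minus the domain. As it contains
    no node, every node lies either in the domain or off its closure.\<close>
  have "interior \<Omega> = \<Omega>"
    using assms(4) by (simp add: bounded_lipschitz_domain_def interior_open)
  hence M: "m \<in> M_minus h \<Omega> \<longleftrightarrow> m \<notin> M_plus h \<Omega>" for m
    using assms(5) closure_subset[of \<Omega>] by (auto simp: M_plus_def M_minus_def frontier_def)
  \<comment> \<open>The density vanishes off the strip, so cutting it to one side of the boundary is
    the same as cutting it to that side of the strip.\<close>
  have plus: "restrict_to (M_plus h \<Omega>) lam = lam_plus"
    by (auto simp: fun_eq_iff restrict_to_def lam_plus_def strip_plus_def indicator_def lam_outside)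
  have minus: "restrict_to (M_minus h \<Omega>) lam = lam_minus"
    by (auto simp: fun_eq_iff restrict_to_def lam_minus_def strip_minus_def indicator_def lam_outside)
  have "lam_minus m = lam m - lam_plus m" "lam_plus m = lam m - lam_minus m" for m
    unfolding plus[symmetric] minus[symmetric] by (auto simp: restrict_to_def indicator_def M)
  hence split: "lam_minus = (\<lambda>m. lam m - lam_plus m)" "lam_plus = (\<lambda>m. lam m - lam_minus m)"
    by blast+
  \<comment> \<open>Both terms of the potential are convolutions, of \<open>lam\<close> and of
    \<open>lam_plus\<close>, so their difference is the convolution of
    \<open>lam_minus\<close>.\<close>
  have P: "P_potential h k \<Omega> V = green_conv h k lam_minus"
    by (subst split(1)) (simp add: fun_eq_iff P_potential_def LV plus green_conv_diff fin_lam flip: V_def)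
  have Q: "Q_potential h k \<Omega> V = green_conv h k lam_plus"
    by (subst split(2)) (simp add: fun_eq_iff Q_potential_def LV minus green_conv_diff fin_lam flip: V_def)
  have sh: "shielding_control h k \<Omega> V = (\<lambda>m. - lam_minus m)"
    by (simp add: shielding_control_def LV minus)
  have conf: "confinement_control h k \<Omega> V = (\<lambda>m. - lam_plus m)"
    by (simp add: confinement_control_def LV plus)
  \<comment> \<open>The outgoing alternative of admissibility holds. \<open>V\<close> is unfolded
    only after \<open>LV\<close> has rewritten its image under the operator to
    \<open>lam\<close>.\<close>
  have "admissible_extension h k \<Omega> \<xi> V"
    using trace fin_lam(1) by (simp add: admissible_extension_def LV) (simp add: V_def)
  with trace LV P Q sh conf show ?thesis
    unfolding Let_def lam_def[symmetric] V_def[symmetric] lam_plus_def[symmetric] lam_minus_def[symmetric]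
    by (simp add: green_conv_uminus)
qed

end
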